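(* Let $q$ be a prime power, $m,l,k$ integers with $3\le k\le\min\{m+1,l\}$, and $1\le r\le k-1$. Then the number of $G$-orbits on $\Omega_{k,r}^{k-1}$ is $$|\mathcal F_{k,r}^{k-1}|=n_{r+1}^l .$$ In particular, given a positive integer $u\mid\gcd(r+1,l)$, the number of $G$-orbits containing some $T(u_1,\dots,u_r)\in\Omega_{k,r}^{k-1}$ with $H_{\langle 1,u_1,\dots,u_r\rangle}\cong\mathrm{GF}(q^u)^*$ equals $n_{r+1,u}^l$.
   Context: $V$ is an $m$-dimensional vector space over $\mathrm{GF}(q^l)$ with basis $Y_1,\dots,Y_m$, regarded also as an $ml$-dimensional space over $\mathrm{GF}(q)$. $G=\mathrm{GL}(m,q^l)$ acts $\mathrm{GF}(q^l)$-linearly on $V$ and hence on its $\mathrm{GF}(q)$-subspaces. $H$ is a Singer cycle of $\mathrm{GF}(q^l)$, i.e. the group of multiplications by elements of $\mathrm{GF}(q^l)^*$, acting on $\mathrm{GF}(q)$-subspaces of $\mathrm{GF}(q^l)$; $H_W$ is the stabilizer of $W$ in $H$. $\langle\cdot\rangle$ denotes $\mathrm{GF}(q)$-span. For $1\le r\le k-1$ and $u_1,\dots,u_r\in\mathrm{GF}(q^l)$ with $1,u_1,\dots,u_r$ linearly independent over $\mathrm{GF}(q)$, $$T(u_1,\dots,u_r)=\langle Y_1,\dots,Y_{k-1},\,u_1Y_1+\cdots+u_rY_r\rangle,$$ a $k$-dimensional $\mathrm{GF}(q)$-subspace of $V$. $\Omega_{k,r}^{k-1}$ is the union of all $G$-orbits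 of such $T(u_1,\dots,u_r)$, and $\mathcal F_{k,r}^{k-1}$ is a complete set of representatives of the $G$-orbits on $\Omega_{k,r}^{k-1}$. $n_d^l$ is the number of $H$-orbits on the set of $d$-dimensional $\mathrm{GF}(q)$-subspaces of $\mathrm{GF}(q^l)$, and for $u\mid\gcd(d,l)$, $n_{d,u}^l$ is the number of those $H$-orbits whose members have stabilizer in $H$ isomorphic to $\mathrm{GF}(q^u)^*$. Explicitly, with $\mu$ the Möbius function and Gaussian binomial coefficients, $$n_d^l=\frac1{q^l-1}\sum_{t\mid\gcd(d,l)}\begin{bmatrix} l/t\\ d/t\end{bmatrix}_{q^t}\Big(\sum_{u\mid t}\mu(t/u)(q^u-1)\Big),\qquad n_{d,u}^l=\frac{q^u-1}{q^l-1}\sum_{t:\,u\mid t\mid\gcd(d,l)}\mu(t/u)\begin{bmatrix} l/t\\ d/t\end{bmatrix}_{q^t}.$$ *)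

theory Defs
  imports
    "HOL-Library.Cardinality"
    "HOL-Number_Theory.Prime_Powers"
    "HOL-Algebra.Group_Action"
    "HOL-Algebra.Multiplicative_Group"
begin

text \<open>
  The extension of finite fields is modelled by a field type \<open>'f\<close> for \<open>GF(q)\<close>, a field type \<open>'k\<close>
  for \<open>GF(q^l)\<close> and an embedding \<open>emb :: 'f \<Rightarrow> 'k\<close>.  The space \<open>V\<close> is the whole type \<open>'v\<close> with
  scalar multiplication \<open>s :: 'k \<Rightarrow> 'v \<Rightarrow> 'v\<close>; restricting \<open>s\<close> along \<open>emb\<close> makes it a space
  over \<open>GF(q)\<close>, and the same is done with \<open>GF(q^l)\<close> itself, taking \<open>s = (*)\<close>.
  The names are qualified because HOL-Algebra has a locale \<open>module\<close> of its own.
\<close>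

definition field_embedding :: "('f::field \<Rightarrow> 'k::field) \<Rightarrow> bool" where
  "field_embedding emb \<longleftrightarrow>
     emb 1 = 1 \<and> (\<forall>x y. emb (x + y) = emb x + emb y) \<and> (\<forall>x y. emb (x * y) = emb x * emb y)"

definition restrict_scalars ::
    "('f::field \<Rightarrow> 'k::field) \<Rightarrow> ('k \<Rightarrow> 'v::ab_group_add \<Rightarrow> 'v) \<Rightarrow> 'f \<Rightarrow> 'v \<Rightarrow> 'v" where
  "restrict_scalars emb s = (\<lambda>c v. s (emb c) v)"

definition independent_family ::
    "('k::field \<Rightarrow> 'v::ab_group_add \<Rightarrow> 'v) \<Rightarrow> ('i \<Rightarrow> 'v) \<Rightarrow> 'i set \<Rightarrow> bool" where
  "independent_family s x I \<longleftrightarrow> inj_on x I \<and> \<not> Modules.module.dependent s (x ` I)"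

definition basis_family ::
    "('k::field \<Rightarrow> 'v::ab_group_add \<Rightarrow> 'v) \<Rightarrow> ('i \<Rightarrow> 'v) \<Rightarrow> 'i set \<Rightarrow> bool" where
  "basis_family s x I \<longleftrightarrow> independent_family s x I \<and> Modules.module.span s (x ` I) = UNIV"

definition subspaces_dim ::
    "('k::field \<Rightarrow> 'v::ab_group_add \<Rightarrow> 'v) \<Rightarrow> nat \<Rightarrow> 'v set set" where
  "subspaces_dim s d = {W. Modules.module.subspace s W \<and> vector_space.dim s W = d}"

text \<open>
  Both groups consist of bijections of the underlying space, and they act on sets of vectors
  by taking images, so that the action map is \<open>image\<close>.
\<close>

definition GL :: "('k::field \<Rightarrow> 'v::ab_group_add \<Rightarrow> 'v) \<Rightarrow> ('v \<Rightarrow> 'v) monoid" where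
  "GL s = \<lparr>carrier = {g. Vector_Spaces.linear s s g \<and> bij g}, monoid.mult = (\<circ>), one = id\<rparr>"

definition Singer :: "('k::field \<Rightarrow> 'k) monoid" where
  "Singer = \<lparr>carrier = {(*) a | a. a \<noteq> 0}, monoid.mult = (\<circ>), one = id\<rparr>"

definition Singer_stab :: "'k::field set \<Rightarrow> ('k \<Rightarrow> 'k) monoid" where
  "Singer_stab W = Singer\<lparr>carrier := stabilizer Singer image W\<rparr>"

text \<open>\<open>singer_orbits emb d\<close> is the set counted by \<open>n_d^l\<close>.\<close>

definition singer_orbits :: "('f::field \<Rightarrow> 'k::field) \<Rightarrow> nat \<Rightarrow> 'k set set set" where
  "singer_orbits emb d = orbits Singer (subspaces_dim (restrict_scalars emb (*)) d) image"

definition n_orb :: "('f::field \<Rightarrow> 'k::field) \<Rightarrow> nat \<Rightarrow> nat" where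
  "n_orb emb d = card (singer_orbits emb d)"

text \<open>\<open>n_orb_stab emb d F\<close> is \<open>n_{d,u}^l\<close> when \<open>F\<close> is a field with \<open>q^u\<close> elements.\<close>

definition n_orb_stab ::
    "('f::field \<Rightarrow> 'k::field) \<Rightarrow> nat \<Rightarrow> ('e, 'z) ring_scheme \<Rightarrow> nat" where
  "n_orb_stab emb d F =
     card {B \<in> singer_orbits emb d. \<forall>W\<in>B. Singer_stab W \<cong> mult_of F}"

text \<open>
  A tuple \<open>u_1, \<dots>, u_r\<close> is a function \<open>u :: nat \<Rightarrow> 'k\<close> of which only the values on \<open>{1..r}\<close>
  matter.  Overwriting \<open>u 0\<close> by 1 gives the family \<open>1, u_1, \<dots>, u_r\<close> indexed by \<open>{0..r}\<close>.
\<close>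

definition admissible :: "('f::field \<Rightarrow> 'k::field) \<Rightarrow> nat \<Rightarrow> (nat \<Rightarrow> 'k) \<Rightarrow> bool" where
  "admissible emb r u \<longleftrightarrow> independent_family (restrict_scalars emb (*)) (u(0 := 1)) {0..r}"

definition span_1u :: "('f::field \<Rightarrow> 'k::field) \<Rightarrow> nat \<Rightarrow> (nat \<Rightarrow> 'k) \<Rightarrow> 'k set" where
  "span_1u emb r u =
     Modules.module.span (restrict_scalars emb (*)) (insert 1 (u ` {1..r}))"

definition T_space ::
    "('f::field \<Rightarrow> 'k::field) \<Rightarrow> ('k \<Rightarrow> 'v::ab_group_add \<Rightarrow> 'v) \<Rightarrow> (nat \<Rightarrow> 'v) \<Rightarrow>
     nat \<Rightarrow> nat \<Rightarrow> (nat \<Rightarrow> 'k) \<Rightarrow> 'v set" where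
  "T_space emb s Y k r u =
     Modules.module.span (restrict_scalars emb s)
       (insert (\<Sum>i = 1..r. s (u i) (Y i)) (Y ` {1..k - 1}))"

definition Omega ::
    "('f::field \<Rightarrow> 'k::field) \<Rightarrow> ('k \<Rightarrow> 'v::ab_group_add \<Rightarrow> 'v) \<Rightarrow> (nat \<Rightarrow> 'v) \<Rightarrow>
     nat \<Rightarrow> nat \<Rightarrow> 'v set set" where
  "Omega emb s Y k r =
     (\<Union>u \<in> {u. admissible emb r u}. orbit (GL s) image (T_space emb s Y k r u))"

definition complete_representatives ::
    "('g, 'z) monoid_scheme \<Rightarrow> 'b set \<Rightarrow> ('g \<Rightarrow> 'b \<Rightarrow> 'b) \<Rightarrow> 'b set \<Rightarrow> bool" where
  "complete_representatives G E \<phi> R \<longleftrightarrow>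
     R \<subseteq> E \<and> (\<forall>B \<in> orbits G E \<phi>. \<exists>!x. x \<in> R \<and> x \<in> B)"

text \<open>
  The HOL-Algebra locale \<open>group_action\<close> requires action maps that are extensional on the set
  acted on, so the action by images is an instance on the set of all sets of vectors.
\<close>

lemma group_action_image:
  fixes C :: "('v \<Rightarrow> 'v) set"
  assumes id: "id \<in> C"
    and comp: "\<And>g h. g \<in> C \<Longrightarrow> h \<in> C \<Longrightarrow> g \<circ> h \<in> C"
    and bij: "\<And>g. g \<in> C \<Longrightarrow> bij g"
    and inv: "\<And>g. g \<in> C \<Longrightarrow> inv_into UNIV g \<in> C"
  shows "group_action \<lparr>carrier = C, monoid.mult = (\<circ>), one = id\<rparr> UNIV image"
proof -
  let ?G = "\<lparr>carrier = C, monoid.mult = (\<circ>), one = id\<rparr>"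
  have "group ?G"
  proof (rule groupI)
    fix g assume "g \<in> carrier ?G"
    then show "\<exists>h\<in>carrier ?G. h \<otimes>\<^bsub>?G\<^esub> g = \<one>\<^bsub>?G\<^esub>"
      using inv bij by (intro bexI[of _ "inv_into UNIV g"]) (auto simp: bij_is_inj)
  qed (use id comp in \<open>auto simp: comp_assoc\<close>)
  moreover have "bij ((`) g)" if "g \<in> C" for g
    using bij[OF that] by (simp add: bij_def inj_image_eq_iff inj_on_def surj_image_vimage_eq)
      (metis surj_def surj_image_vimage_eq)
  then have "image \<in> hom ?G (BijGroup UNIV)"
    by (auto simp: hom_def BijGroup_def Bij_def compose_def image_comp fun_eq_iff)
  ultimately show ?thesis
    by (simp add: group_action_def group_hom_def group_hom_axioms_def group_BijGroup)
qed

lemma group_action_GL: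
  assumes "vector_space s"
  shows "group_action (GL s) UNIV image"
proof -
  interpret vs: vector_space_pair s s
    using assms by (simp add: vector_space_pair_def)
  show ?thesis
    unfolding GL_def
  proof (rule group_action_image)
    show "id \<in> {g. Vector_Spaces.linear s s g \<and> bij g}"
      using vs.vs1.linear_id by auto
    show "inv_into UNIV g \<in> {g. Vector_Spaces.linear s s g \<and> bij g}"
      if "g \<in> {g. Vector_Spaces.linear s s g \<and> bij g}" for g
    proof -
      from that have l: "Vector_Spaces.linear s s g" and b: "bij g" by auto
      have add: "g (x + y) = g x + g y" and scale: "g (s c x) = s c (g x)" for x y c
        using l by (auto simp: Vector_Spaces.linear_iff)
      have "inv_into UNIV g (x + y) = inv_into UNIV g x + inv_into UNIV g y" for x y
        using b by (intro inv_f_eq) (auto simp: bij_is_inj add bij_is_surj surj_f_inv_f)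
      moreover have "inv_into UNIV g (s c x) = s c (inv_into UNIV g x)" for c x
        using b by (intro inv_f_eq) (auto simp: bij_is_inj scale bij_is_surj surj_f_inv_f)
      ultimately have "Vector_Spaces.linear s s (inv_into UNIV g)"
        using assms by (simp add: Vector_Spaces.linear_iff)
      then show ?thesis using b by (simp add: bij_imp_bij_inv)
    qed
  qed (auto intro: Vector_Spaces.linear_compose bij_comp)
qed

lemma group_action_Singer: "group_action (Singer :: ('k::field \<Rightarrow> 'k) monoid) UNIV image"
proof -
  have inv: "inv_into UNIV ((*) a) = (*) (inverse a)" if "a \<noteq> 0" for a :: 'k
    using that by (intro inv_equality) (auto simp: field_simps)
  show ?thesis
    unfolding Singer_def
  proof (rule group_action_image)
    show "id \<in> {(*) a | a :: 'k. a \<noteq> 0}"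
      by (auto intro!: exI[of _ 1])
    show "g \<circ> h \<in> {(*) a | a :: 'k. a \<noteq> 0}"
      if gh: "g \<in> {(*) a | a. a \<noteq> 0}" "h \<in> {(*) a | a. a \<noteq> 0}" for g h
    proof -
      from gh obtain a b where "g = (*) a" "h = (*) b" "a \<noteq> 0" "b \<noteq> 0" by blast
      then show ?thesis by (auto intro!: exI[of _ "a * b"] simp: mult.assoc fun_eq_iff)
    qed
    show "bij g" if "g \<in> {(*) a | a :: 'k. a \<noteq> 0}" for g
    proof -
      from that obtain a where "g = (*) a" "a \<noteq> 0" by blast
      then show ?thesis
        by (intro o_bij[of "(*) (inverse a)"]) (auto simp: fun_eq_iff)
    qed
    show "inv_into UNIV g \<in> {(*) a | a :: 'k. a \<noteq> 0}" if "g \<in> {(*) a | a. a \<noteq> 0}" for g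
    proof -
      from that obtain a where "g = (*) a" "a \<noteq> 0" by blast
      then show ?thesis using inv[of a] by (auto intro!: exI[of _ "inverse a"])
    qed
  qed
qed

end

theory Submission
  imports Defs
begin

text \<open>
  Two spaces \<open>T(u)\<close> and \<open>T(w)\<close> lie in the same \<open>G\<close>-orbit iff \<open>\<langle>1, u\<^sub>1, \<dots>, u\<^sub>r\<rangle>\<close> and
  \<open>\<langle>1, w\<^sub>1, \<dots>, w\<^sub>r\<rangle>\<close> lie in the same \<open>H\<close>-orbit.  The class of \<open>\<langle>1, u\<^sub>1, \<dots>, u\<^sub>r\<rangle>\<close> is recovered
  from the \<open>GF(q^l)\<close>-linear relations in \<open>T(u)\<close>.  Conversely, if the two spaces agree up to a
  scalar, a change of basis between them induces a \<open>GF(q^l)\<close>-linear map from \<open>T(u)\<close> onto \<open>T(w)\<close>.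
  Since every \<open>H\<close>-orbit on \<open>(r + 1)\<close>-dimensional subspaces has a member containing 1, and \<open>H\<close> is
  abelian, orbits and stabilizers correspond.
\<close>

lemma (in group_action) orbit_eq_iff:
  assumes "x \<in> E" "y \<in> E"
  shows "orbit G \<phi> x = orbit G \<phi> y \<longleftrightarrow> x \<in> orbit G \<phi> y"
proof
  assume "x \<in> orbit G \<phi> y"
  moreover have "orbit G \<phi> x \<in> orbits G E \<phi>" "orbit G \<phi> y \<in> orbits G E \<phi>"
    using assms by (auto simp: orbits_def)
  ultimately show "orbit G \<phi> x = orbit G \<phi> y"
    using disjoint_union orbit_refl[OF assms(1)] by blast
qed (use orbit_refl[OF assms(1)] in simp)

lemma field_embedding_simps:
  assumes "field_embedding emb"
  shows "emb 0 = 0" "emb 1 = 1" "emb (x + y) = emb x + emb y" "emb (x * y) = emb x * emb y"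
    "emb (- x) = - emb x"
proof -
  show add: "emb (x + y) = emb x + emb y" for x y
    using assms by (simp add: field_embedding_def)
  show zero: "emb 0 = 0"
    using add[of 0 0] by (metis add_cancel_left_right)
  show "emb (- x) = - emb x"
    using add[of x "- x"] zero by (simp add: eq_neg_iff_add_eq_0 add.commute)
qed (use assms in \<open>auto simp: field_embedding_def\<close>)

lemma field_embedding_sum:
  assumes "field_embedding emb"
  shows "emb (sum f A) = (\<Sum>i\<in>A. emb (f i))"
  by (induction A rule: infinite_finite_induct) (auto simp: field_embedding_simps[OF assms])

lemma field_embedding_inj:
  assumes "field_embedding emb" "emb x = 0"
  shows "x = 0"
proof (rule ccontr)
  assume "x \<noteq> 0"
  then have "emb (x * inverse x) = 1"
    using assms(1) by (simp add: field_embedding_simps)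
  then show False
    using assms field_embedding_simps(4)[OF assms(1)] by simp
qed

lemma vector_space_times: "vector_space ((*) :: 'a::field \<Rightarrow> 'a \<Rightarrow> 'a)"
  by unfold_locales (auto simp: algebra_simps)

lemma vector_space_restrict_scalars:
  assumes "field_embedding emb" "vector_space s"
  shows "vector_space (restrict_scalars emb s)"
proof -
  interpret vector_space s by fact
  show ?thesis
    unfolding restrict_scalars_def
    by unfold_locales
      (auto simp: field_embedding_simps[OF assms(1)] scale_right_distrib scale_left_distrib)
qed

lemma independent_family_extend:
  assumes "independent_family s x I" "vector_space s" "vector_space t"
  shows "\<exists>g. Vector_Spaces.linear s t g \<and> (\<forall>i\<in>I. g (x i) = f i)"
proof -
  interpret vector_space_pair s t
    using assms by (simp add: vector_space_pair_def)
  have "inj_on x I" and "vs1.independent (x ` I)"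
    using assms(1) by (auto simp: independent_family_def)
  then obtain g where g: "Vector_Spaces.linear s t g"
    "\<forall>v\<in>x ` I. g v = (f \<circ> the_inv_into I x) v"
    using linear_independent_extend by blast
  then show ?thesis
    by (intro exI[of _ g]) (simp add: the_inv_into_f_f[OF \<open>inj_on x I\<close>])
qed

lemma linear_family_sum:
  assumes "Vector_Spaces.linear s t g"
  shows "g (\<Sum>i\<in>I. s (c i) (x i)) = (\<Sum>i\<in>I. t (c i) (g (x i)))"
proof -
  interpret Vector_Spaces.linear s t g by fact
  show ?thesis by (simp add: sum scale)
qed

definition dual_family ::
    "('k::field \<Rightarrow> 'v::ab_group_add \<Rightarrow> 'v) \<Rightarrow> ('i \<Rightarrow> 'v) \<Rightarrow> 'i set \<Rightarrow> ('i \<Rightarrow> 'v \<Rightarrow> 'k) \<Rightarrow> bool" where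
  "dual_family s x I e \<longleftrightarrow> (\<forall>j. Vector_Spaces.linear s (*) (e j)) \<and>
     (\<forall>i\<in>I. \<forall>j. e j (x i) = (if i = j then 1 else 0))"

lemma dual_family_linear: "dual_family s x I e \<Longrightarrow> Vector_Spaces.linear s (*) (e j)"
  by (simp add: dual_family_def)

lemma dual_family_apply: "dual_family s x I e \<Longrightarrow> i \<in> I \<Longrightarrow> e j (x i) = (if i = j then 1 else 0)"
  by (simp add: dual_family_def)

lemma dual_family_exists:
  assumes "independent_family s x I" "vector_space s"
  shows "\<exists>e. dual_family s x I e"
proof -
  have "\<forall>j. \<exists>g. Vector_Spaces.linear s (*) g \<and> (\<forall>i\<in>I. g (x i) = (if i = j then 1 else 0))"
    by (intro allI independent_family_extend[OF assms vector_space_times])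
  then have "\<exists>e. \<forall>j. Vector_Spaces.linear s (*) (e j) \<and> (\<forall>i\<in>I. e j (x i) = (if i = j then 1 else 0))"
    by (rule choice)
  then show ?thesis unfolding dual_family_def by blast
qed

lemma independent_family_sum_0:
  assumes "independent_family s x I" "vector_space s" "finite I"
    and "(\<Sum>i\<in>I. s (c i) (x i)) = 0" "i \<in> I"
  shows "c i = 0"
proof -
  obtain e where e: "dual_family s x I e"
    using dual_family_exists[OF assms(1,2)] by blast
  interpret Vector_Spaces.linear s "(*)" "e i" by (rule dual_family_linear[OF e])
  have "0 = e i (\<Sum>j\<in>I. s (c j) (x j))" using assms(4) zero by simp
  also have "\<dots> = (\<Sum>j\<in>I. c j * e i (x j))" by (rule linear_family_sum[OF dual_family_linear[OF e]])
  also have "\<dots> = (\<Sum>j\<in>I. if j = i then c j else 0)" by (intro sum.cong) (auto simp: dual_family_apply[OF e])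
  also have "\<dots> = c i" using assms(3,5) by simp
  finally show ?thesis by simp
qed

lemma independent_familyI:
  fixes s :: "'k::field \<Rightarrow> 'v::ab_group_add \<Rightarrow> 'v"
  assumes "vector_space s" "finite I"
    and zero: "\<And>c i. (\<Sum>i\<in>I. s (c i) (x i)) = 0 \<Longrightarrow> i \<in> I \<Longrightarrow> c i = 0"
  shows "independent_family s x I"
proof -
  interpret vector_space s by fact
  have inj: "inj_on x I"
  proof (rule inj_onI, rule ccontr)
    fix i j assume ij: "i \<in> I" "j \<in> I" "x i = x j" "i \<noteq> j"
    let ?c = "\<lambda>n. if n = i then 1 :: 'k else if n = j then -1 else 0"
    have "(\<Sum>n\<in>I. s (?c n) (x n)) = (\<Sum>n\<in>{i, j}. s (?c n) (x n))"
      using ij assms(2) by (intro sum.mono_neutral_right) auto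
    also have "\<dots> = 0" using ij by simp
    finally have "?c i = 0" using ij(1) by (rule zero)
    then show False by simp
  qed
  have "independent (x ` I)"
  proof (rule independent_if_scalars_zero)
    fix f v assume "(\<Sum>v\<in>x ` I. s (f v) v) = 0" and v: "v \<in> x ` I"
    then have "(\<Sum>i\<in>I. s (f (x i)) (x i)) = 0"
      by (simp add: sum.reindex[OF inj])
    then show "f v = 0" using v zero[of "\<lambda>i. f (x i)"] by auto
  qed (use assms in simp)
  then show ?thesis using inj by (simp add: independent_family_def)
qed

lemma span_independent_family:
  assumes "independent_family s x I" "vector_space s" "finite I"
  shows "Modules.module.span s (x ` I) = range (\<lambda>c. \<Sum>i\<in>I. s (c i) (x i))"
proof -
  interpret vector_space s by fact
  have inj: "inj_on x I" using assms(1) by (simp add: independent_family_def)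
  have "span (x ` I) = range (\<lambda>f. \<Sum>i\<in>I. s (f (x i)) (x i))"
    using assms(3) by (subst span_finite) (auto simp: sum.reindex[OF inj])
  also have "\<dots> = range (\<lambda>c. \<Sum>i\<in>I. s (c i) (x i))"
  proof (intro equalityI image_subsetI)
    fix f
    show "(\<Sum>i\<in>I. s (f (x i)) (x i)) \<in> range (\<lambda>c. \<Sum>i\<in>I. s (c i) (x i))"
      by (rule range_eqI[of _ _ "\<lambda>i. f (x i)"]) simp
  next
    fix c
    have "(\<Sum>i\<in>I. s (c i) (x i)) = (\<Sum>i\<in>I. s (c (the_inv_into I x (x i))) (x i))"
      by (intro sum.cong) (auto simp: the_inv_into_f_f[OF inj])
    then show "(\<Sum>i\<in>I. s (c i) (x i)) \<in> range (\<lambda>f. \<Sum>i\<in>I. s (f (x i)) (x i))"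
      by (intro range_eqI[where x = "\<lambda>v. c (the_inv_into I x v)"]) simp
  qed
  finally show ?thesis .
qed

lemma dual_family_expand:
  assumes "independent_family s x I" "vector_space s" "finite I"
    and e: "dual_family s x I e"
    and "v \<in> Modules.module.span s (x ` I)"
  shows "v = (\<Sum>j\<in>I. s (e j v) (x j))"
proof -
  obtain c where c: "v = (\<Sum>i\<in>I. s (c i) (x i))"
    using assms(5) span_independent_family[OF assms(1-3)] by auto
  have "e j v = c j" if "j \<in> I" for j
  proof -
    have "e j v = (\<Sum>i\<in>I. c i * e j (x i))" unfolding c by (rule linear_family_sum[OF dual_family_linear[OF e]])
    also have "\<dots> = (\<Sum>i\<in>I. if i = j then c i else 0)" by (intro sum.cong) (auto simp: dual_family_apply[OF e])
    finally show ?thesis using that assms(3) by simp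
  qed
  then show ?thesis using c by simp
qed

text \<open>
  The relations \<open>\<Sum> c\<^sub>i t\<^sub>i = 0\<close> over \<open>GF(q^l)\<close> among elements of \<open>T\<close> form the kernel of
  \<open>GF(q^l) \<otimes> T \<rightarrow> V\<close>; a relation is mapped to the space of its values under the functionals
  \<open>T \<rightarrow> GF(q)\<close>.  For \<open>T = T(u\<^sub>1, \<dots>, u\<^sub>r)\<close> the kernel is a line, so that these spaces are the
  multiples of \<open>\<langle>1, u\<^sub>1, \<dots>, u\<^sub>r\<rangle>\<close>.
\<close>

definition relation_values ::
    "('f::field \<Rightarrow> 'k::field) \<Rightarrow> ('k \<Rightarrow> 'v::ab_group_add \<Rightarrow> 'v) \<Rightarrow> 'i set \<Rightarrow>
     ('i \<Rightarrow> 'k) \<Rightarrow> ('i \<Rightarrow> 'v) \<Rightarrow> 'k set" where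
  "relation_values emb s I c t =
     {\<Sum>i\<in>I. c i * emb (\<phi> (t i)) | \<phi>. Vector_Spaces.linear (restrict_scalars emb s) (*) \<phi>}"

lemma relation_valuesI:
  assumes "Vector_Spaces.linear (restrict_scalars emb s) (*) \<phi>"
    and "y = (\<Sum>i\<in>I. c i * emb (\<phi> (t i)))"
  shows "y \<in> relation_values emb s I c t"
  unfolding relation_values_def using assms by blast

lemma relation_valuesE:
  assumes "y \<in> relation_values emb s I c t"
  obtains \<phi> where "Vector_Spaces.linear (restrict_scalars emb s) (*) \<phi>"
    "y = (\<Sum>i\<in>I. c i * emb (\<phi> (t i)))"
  using assms unfolding relation_values_def by blast

lemma linear_restrict_scalars:
  assumes "field_embedding emb" "vector_space s" "Vector_Spaces.linear s s g"
  shows "Vector_Spaces.linear (restrict_scalars emb s) (restrict_scalars emb s) g"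
  using assms vector_space_restrict_scalars[OF assms(1,2)]
  by (auto simp: Vector_Spaces.linear_iff restrict_scalars_def)

lemma linear_GL:
  "g \<in> carrier (GL s) \<Longrightarrow> Vector_Spaces.linear s s g"
  by (simp add: GL_def)

lemma relation_values_GL:
  assumes emb: "field_embedding emb" and s: "vector_space s"
    and g: "g \<in> carrier (GL s)" "h \<in> carrier (GL s)" "h \<circ> g = id"
  shows "relation_values emb s I c (g \<circ> t) = relation_values emb s I c t"
proof -
  note lin = linear_restrict_scalars[OF emb s linear_GL[OF g(1)]]
    linear_restrict_scalars[OF emb s linear_GL[OF g(2)]]
  have hg: "h (g v) = v" for v using g(3) by (simp add: fun_eq_iff)
  show ?thesis
  proof (intro equalityI subsetI)
    fix y assume "y \<in> relation_values emb s I c (g \<circ> t)"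
    then obtain \<phi> where \<phi>: "Vector_Spaces.linear (restrict_scalars emb s) (*) \<phi>"
      and y: "y = (\<Sum>i\<in>I. c i * emb (\<phi> ((g \<circ> t) i)))"
      by (rule relation_valuesE)
    show "y \<in> relation_values emb s I c t"
      by (rule relation_valuesI[OF Vector_Spaces.linear_compose[OF lin(1) \<phi>]]) (simp add: y)
  next
    fix y assume "y \<in> relation_values emb s I c t"
    then obtain \<phi> where \<phi>: "Vector_Spaces.linear (restrict_scalars emb s) (*) \<phi>"
      and y: "y = (\<Sum>i\<in>I. c i * emb (\<phi> (t i)))"
      by (rule relation_valuesE)
    show "y \<in> relation_values emb s I c (g \<circ> t)"
      by (rule relation_valuesI[OF Vector_Spaces.linear_compose[OF lin(2) \<phi>]]) (simp add: y hg)
  qed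
qed

locale T_spaces =
  fixes emb :: "'f::field \<Rightarrow> 'k::field"
    and s :: "'k \<Rightarrow> 'v::ab_group_add \<Rightarrow> 'v"
    and Y :: "nat \<Rightarrow> 'v"
    and m k r :: nat
  assumes emb: "field_embedding emb" and s: "vector_space s" and Y: "basis_family s Y {1..m}"
    and r: "1 \<le> r" "r \<le> k - 1" and k: "k - 1 \<le> m"
begin

abbreviation sF :: "'f \<Rightarrow> 'v \<Rightarrow> 'v" where "sF \<equiv> restrict_scalars emb s"
abbreviation mF :: "'f \<Rightarrow> 'k \<Rightarrow> 'k" where "mF \<equiv> restrict_scalars emb (*)"

sublocale K: vector_space s by (fact s)
sublocale F: vector_space sF by (rule vector_space_restrict_scalars[OF emb s])
sublocale KF: vector_space mF by (rule vector_space_restrict_scalars[OF emb vector_space_times])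

abbreviation indep :: "(nat \<Rightarrow> 'k) \<Rightarrow> bool" where "indep b \<equiv> independent_family mF b {0..r}"
abbreviation U :: "(nat \<Rightarrow> 'k) \<Rightarrow> 'k set" where "U b \<equiv> KF.span (b ` {0..r})"

text \<open>
  Working with arbitrary bases \<open>b\<^sub>0, \<dots>, b\<^sub>r\<close> in place of \<open>1, u\<^sub>1, \<dots>, u\<^sub>r\<close> makes the situation
  symmetric; the sign gives the generators of \<open>T\<close> the relation \<open>\<Sum> b\<^sub>j x\<^sub>j = 0\<close>.
\<close>

definition gen :: "(nat \<Rightarrow> 'k) \<Rightarrow> nat \<Rightarrow> 'v" where
  "gen b j = (if j = 0 then - (\<Sum>i=1..r. s (b i / b 0) (Y i)) else Y j)"

definition T :: "(nat \<Rightarrow> 'k) \<Rightarrow> 'v set" where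
  "T b = F.span (gen b ` {0..k-1})"

lemma indep_nonzero: "indep b \<Longrightarrow> b 0 \<noteq> 0"
  using KF.dependent_zero by (force simp: independent_family_def)

lemma T_eq_T_space: "T b = T_space emb s Y k r (\<lambda>i. b i / b 0)"
proof -
  let ?v = "\<Sum>i=1..r. s (b i / b 0) (Y i)"
  have "{0..k-1} = insert 0 {1..k-1}" by auto
  then have "gen b ` {0..k-1} = insert (- ?v) (Y ` {1..k-1})"
    by (auto simp: gen_def)
  moreover have "F.span (insert (- v) A) \<subseteq> F.span (insert v A)" for v A
    by (rule F.span_minimal) (auto intro: F.span_base F.span_neg)
  then have "F.span (insert (- v) A) = F.span (insert v A)" for v A
    by (intro equalityI) (metis add.inverse_inverse)+
  ultimately show ?thesis
    by (simp add: T_def T_space_def)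
qed

lemma gen_relation:
  assumes "b 0 \<noteq> 0"
  shows "(\<Sum>j=0..r. s (b j) (gen b j)) = 0"
proof -
  have "(\<Sum>j=0..r. s (b j) (gen b j)) = s (b 0) (gen b 0) + (\<Sum>j=1..r. s (b j) (gen b j))"
    by (simp add: sum.atLeast_Suc_atMost)
  also have "s (b 0) (gen b 0) = - (\<Sum>j=1..r. s (b j) (Y j))"
    using assms by (simp add: gen_def K.scale_sum_right)
  also have "(\<Sum>j=1..r. s (b j) (gen b j)) = (\<Sum>j=1..r. s (b j) (Y j))"
    by (intro sum.cong) (auto simp: gen_def)
  finally show ?thesis by simp
qed

lemma Y_sum_0:
  assumes "(\<Sum>i=1..k-1. s (c i) (Y i)) = 0" "i \<in> {1..k-1}"
  shows "c i = 0"
proof -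
  let ?c = "\<lambda>i. if i \<le> k - 1 then c i else 0"
  have "(\<Sum>i=1..m. s (?c i) (Y i)) = (\<Sum>i=1..k-1. s (?c i) (Y i))"
    using k by (intro sum.mono_neutral_right) auto
  then have "(\<Sum>i=1..m. s (?c i) (Y i)) = 0"
    using assms(1) by simp
  then have "?c i = 0"
    using assms(2) k Y
    by (intro independent_family_sum_0[OF _ s _ \<open>(\<Sum>i=1..m. s (?c i) (Y i)) = 0\<close>])
      (auto simp: basis_family_def)
  then show ?thesis using assms(2) by simp
qed

lemma gen_sum_0:
  assumes b: "b 0 \<noteq> 0" and sum_0: "(\<Sum>j=0..k-1. s (d j) (gen b j)) = 0" and "j \<le> k - 1"
  shows "d j = (if j \<le> r then d 0 / b 0 * b j else 0)"
proof (cases "j = 0")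
  case False
  define c where "c i = (if i \<le> r then d 0 * (b i / b 0) else 0)" for i
  have "(\<Sum>j=0..k-1. s (d j) (gen b j)) = s (d 0) (gen b 0) + (\<Sum>j=1..k-1. s (d j) (gen b j))"
    by (simp add: sum.atLeast_Suc_atMost)
  also have "s (d 0) (gen b 0) = - (\<Sum>j=1..r. s (c j) (Y j))"
    by (simp add: gen_def K.scale_sum_right c_def)
  also have "(\<Sum>j=1..r. s (c j) (Y j)) = (\<Sum>j=1..k-1. s (c j) (Y j))"
    using r by (intro sum.mono_neutral_left) (auto simp: c_def)
  also have "(\<Sum>j=1..k-1. s (d j) (gen b j)) = (\<Sum>j=1..k-1. s (d j) (Y j))"
    by (intro sum.cong) (auto simp: gen_def)
  finally have "(\<Sum>j=1..k-1. s (d j - c j) (Y j)) = 0"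
    using sum_0 by (simp add: K.scale_left_diff_distrib sum_subtractf)
  then have "d j - c j = 0"
    by (rule Y_sum_0) (use False \<open>j \<le> k - 1\<close> in auto)
  then show ?thesis by (simp add: c_def)
qed (use b in simp)

lemma gen_independent:
  assumes b: "indep b"
  shows "independent_family sF (gen b) {0..k-1}"
proof (rule independent_familyI[OF F.vector_space_axioms])
  fix c :: "nat \<Rightarrow> 'f" and i
  assume "(\<Sum>j=0..k-1. sF (c j) (gen b j)) = 0" and i: "i \<in> {0..k-1}"
  then have "(\<Sum>j=0..k-1. s (emb (c j)) (gen b j)) = 0"
    by (simp add: restrict_scalars_def)
  note * = gen_sum_0[of b, OF indep_nonzero[OF b] this]
  obtain e where e: "dual_family mF b {0..r} e"
    using dual_family_exists[OF b KF.vector_space_axioms] by blast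
  interpret Vector_Spaces.linear mF "(*)" "e 0" by (rule dual_family_linear[OF e])
  have "emb (c 1) * b 0 = emb (c 0) * b 1"
    using *[of 1] r indep_nonzero[OF b] by (simp add: field_simps)
  then have "mF (c 1) (b 0) = mF (c 0) (b 1)" by (simp add: restrict_scalars_def)
  then have "c 1 * e 0 (b 0) = c 0 * e 0 (b 1)" by (metis scale)
  then have "c 1 = 0" using dual_family_apply[OF e] r by simp
  then have "emb (c 0) * b 1 = 0"
    using \<open>emb (c 1) * b 0 = emb (c 0) * b 1\<close> field_embedding_simps[OF emb] by simp
  moreover have "b 1 \<noteq> 0"
    using b r KF.dependent_zero by (force simp: independent_family_def)
  ultimately have "emb (c 0) = 0" by simp
  then have "emb (c i) = 0"
    using *[of i] i by simp
  then show "c i = 0"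
    by (rule field_embedding_inj[OF emb])
qed simp

lemma relation_values_gen:
  assumes b: "indep b"
  shows "relation_values emb s {0..r} b (gen b) = U b"
proof -
  have "U b = range (\<lambda>c. \<Sum>i=0..r. mF (c i) (b i))"
    by (rule span_independent_family[OF b KF.vector_space_axioms]) simp
  also have "\<dots> = relation_values emb s {0..r} b (gen b)"
  proof (intro equalityI subsetI)
    fix y assume "y \<in> range (\<lambda>c. \<Sum>i=0..r. mF (c i) (b i))"
    then obtain c where y: "y = (\<Sum>i=0..r. mF (c i) (b i))" by blast
    obtain \<phi> where \<phi>: "Vector_Spaces.linear sF (*) \<phi>" "\<forall>i\<in>{0..k-1}. \<phi> (gen b i) = c i"
      using independent_family_extend[OF gen_independent[OF b] F.vector_space_axioms
          vector_space_times, of c] by blast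
    have "y = (\<Sum>i=0..r. b i * emb (\<phi> (gen b i)))"
      unfolding y using r by (intro sum.cong) (auto simp: \<phi>(2) restrict_scalars_def)
    then show "y \<in> relation_values emb s {0..r} b (gen b)"
      by (rule relation_valuesI[OF \<phi>(1)])
  next
    fix y assume "y \<in> relation_values emb s {0..r} b (gen b)"
    then obtain \<phi> where "y = (\<Sum>i=0..r. b i * emb (\<phi> (gen b i)))"
      by (rule relation_valuesE)
    then show "y \<in> range (\<lambda>c. \<Sum>i=0..r. mF (c i) (b i))"
      by (intro range_eqI[of _ _ "\<lambda>i. \<phi> (gen b i)"]) (simp add: restrict_scalars_def mult.commute)
  qed
  finally show ?thesis by simp
qed

lemma relation_values_T:
  assumes b: "indep b" and t: "\<And>i. i \<in> I \<Longrightarrow> t i \<in> T b" and rel: "(\<Sum>i\<in>I. s (c i) (t i)) = 0"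
  obtains d where "relation_values emb s I c t = (*) d ` U b"
proof -
  obtain e where e: "dual_family sF (gen b) {0..k-1} e"
    using dual_family_exists[OF gen_independent[OF b] F.vector_space_axioms] by blast
  have t_eq: "t i = (\<Sum>j=0..k-1. sF (e j (t i)) (gen b j))" if "i \<in> I" for i
    using dual_family_expand[OF gen_independent[OF b] F.vector_space_axioms _ e]
      t[OF that] by (simp add: T_def)
  define d where "d j = (\<Sum>i\<in>I. c i * emb (e j (t i)))" for j
  have "(\<Sum>i\<in>I. s (c i) (t i)) = (\<Sum>i\<in>I. \<Sum>j=0..k-1. s (c i * emb (e j (t i))) (gen b j))"
  proof (rule sum.cong[OF refl])
    fix i assume "i \<in> I"
    have "s (c i) (t i) = s (c i) (\<Sum>j=0..k-1. sF (e j (t i)) (gen b j))"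
      using t_eq[OF \<open>i \<in> I\<close>] by simp
    then show "s (c i) (t i) = (\<Sum>j=0..k-1. s (c i * emb (e j (t i))) (gen b j))"
      by (simp add: K.scale_sum_right restrict_scalars_def)
  qed
  also have "\<dots> = (\<Sum>j=0..k-1. s (d j) (gen b j))"
    unfolding d_def by (subst sum.swap) (simp add: K.scale_sum_left)
  finally have d: "d j = (if j \<le> r then d 0 / b 0 * b j else 0)" if "j \<le> k - 1" for j
    using gen_sum_0[where b = b and d = d, OF indep_nonzero[OF b]] rel that by simp
  have "(\<Sum>i\<in>I. c i * emb (\<phi> (t i))) = d 0 / b 0 * (\<Sum>j=0..r. b j * emb (\<phi> (gen b j)))"
    if \<phi>: "Vector_Spaces.linear sF (*) \<phi>" for \<phi>
  proof -
    have "(\<Sum>i\<in>I. c i * emb (\<phi> (t i)))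
        = (\<Sum>i\<in>I. \<Sum>j=0..k-1. c i * emb (e j (t i)) * emb (\<phi> (gen b j)))"
    proof (rule sum.cong[OF refl])
      fix i assume "i \<in> I"
      have "\<phi> (t i) = (\<Sum>j=0..k-1. e j (t i) * \<phi> (gen b j))"
        using arg_cong[OF t_eq[OF \<open>i \<in> I\<close>], of \<phi>] linear_family_sum[OF \<phi>] by simp
      then show "c i * emb (\<phi> (t i)) = (\<Sum>j=0..k-1. c i * emb (e j (t i)) * emb (\<phi> (gen b j)))"
        by (simp add: field_embedding_sum[OF emb] field_embedding_simps[OF emb] sum_distrib_left
            mult.assoc)
    qed
    also have "\<dots> = (\<Sum>j=0..k-1. d j * emb (\<phi> (gen b j)))"
      unfolding d_def by (subst sum.swap) (simp add: sum_distrib_right)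
    also have "\<dots> = (\<Sum>j=0..k-1. if j \<le> r then d 0 / b 0 * (b j * emb (\<phi> (gen b j))) else 0)"
    proof (rule sum.cong[OF refl])
      fix j assume "j \<in> {0..k-1}"
      then show "d j * emb (\<phi> (gen b j)) = (if j \<le> r then d 0 / b 0 * (b j * emb (\<phi> (gen b j))) else 0)"
        by (subst d) auto
    qed
    also have "\<dots> = (\<Sum>j=0..r. d 0 / b 0 * (b j * emb (\<phi> (gen b j))))"
      using r by (intro sum.mono_neutral_cong_right) auto
    finally show ?thesis by (simp add: sum_distrib_left)
  qed
  note vals = this
  have "relation_values emb s I c t
      = (*) (d 0 / b 0) ` relation_values emb s {0..r} b (gen b)"
  proof (intro equalityI subsetI)
    fix y assume "y \<in> relation_values emb s I c t"
    then obtain \<phi> where \<phi>: "Vector_Spaces.linear sF (*) \<phi>" "y = (\<Sum>i\<in>I. c i * emb (\<phi> (t i)))"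
      by (rule relation_valuesE)
    show "y \<in> (*) (d 0 / b 0) ` relation_values emb s {0..r} b (gen b)"
      unfolding \<phi>(2) vals[OF \<phi>(1)] by (intro imageI relation_valuesI[OF \<phi>(1) refl])
  next
    fix y assume "y \<in> (*) (d 0 / b 0) ` relation_values emb s {0..r} b (gen b)"
    then obtain z where y: "y = d 0 / b 0 * z" and z: "z \<in> relation_values emb s {0..r} b (gen b)"
      by (rule imageE)
    from z obtain \<phi> where \<phi>: "Vector_Spaces.linear sF (*) \<phi>"
        "z = (\<Sum>j=0..r. b j * emb (\<phi> (gen b j)))"
      by (rule relation_valuesE)
    show "y \<in> relation_values emb s I c t"
      unfolding y \<phi>(2) by (rule relation_valuesI[OF \<phi>(1) vals[OF \<phi>(1), symmetric]])
  qed
  then show thesis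
    using that relation_values_gen[OF b] by metis
qed

lemma U_scaled_if_T_orbit:
  assumes b: "indep b" "indep b'" and orb: "T b' \<in> orbit (GL s) image (T b)"
  obtains a where "a \<noteq> 0" "U b = (*) a ` U b'"
proof -
  interpret G: group_action "GL s" UNIV image by (rule group_action_GL[OF s])
  interpret group "GL s" by (rule group_hom.axioms(1)[OF G.group_hom])
  obtain g where g: "g \<in> carrier (GL s)" "T b' = g ` T b"
    using orb by (auto simp: orbit_def)
  have "inv\<^bsub>GL s\<^esub> g \<in> carrier (GL s)" "inv\<^bsub>GL s\<^esub> g \<circ> g = id"
    using l_inv[OF g(1)] inv_closed[OF g(1)] by (simp_all add: GL_def)
  then have "relation_values emb s {0..r} b (g \<circ> gen b) = U b"
    using relation_values_GL[OF emb s g(1)] relation_values_gen[OF b(1)] by metis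
  moreover have "(g \<circ> gen b) i \<in> T b'" if "i \<in> {0..r}" for i
  proof -
    have "gen b i \<in> T b" using that r by (auto simp: T_def intro!: F.span_base)
    then show ?thesis by (simp add: g(2))
  qed
  moreover have "(\<Sum>i=0..r. s (b i) ((g \<circ> gen b) i)) = 0"
  proof -
    interpret Vector_Spaces.linear s s g by (rule linear_GL[OF g(1)])
    show ?thesis
      using linear_family_sum[OF linear_GL[OF g(1)], of b "gen b" "{0..r}"]
        gen_relation[of b, OF indep_nonzero[OF b(1)]] by (simp add: zero)
  qed
  ultimately obtain a where a: "U b = (*) a ` U b'"
    using relation_values_T[OF b(2), of "{0..r}" "g \<circ> gen b" b] by metis
  moreover have "a \<noteq> 0"
  proof
    assume "a = 0"
    then have "b 0 = 0" using a KF.span_base[of "b 0" "b ` {0..r}"] by auto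
    then show False using indep_nonzero[OF b(1)] by simp
  qed
  ultimately show thesis using that by metis
qed

text \<open>
  Up to the generators \<open>Y\<^sub>j\<close> with \<open>j > r\<close>, \<open>T b\<close> is the image under \<open>P b\<close> of the dual space of
  \<open>U b\<close>.  If \<open>U b = U b'\<close>, then the elements of \<open>T b\<close> and \<open>T b'\<close> are labelled by the same
  functionals, and \<open>P b \<beta> \<mapsto> P b' \<beta>\<close> respects the relations of \<open>gen b\<close>.
\<close>

definition P :: "(nat \<Rightarrow> 'k) \<Rightarrow> ('k \<Rightarrow> 'f) \<Rightarrow> 'v" where
  "P b \<beta> = (\<Sum>i=0..r. sF (\<beta> (b i)) (gen b i))"

lemma P_in_T: "P b \<beta> \<in> T b"
  unfolding P_def T_def using r by (intro F.span_sum F.span_scale F.span_base) auto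

definition transfers :: "(nat \<Rightarrow> 'k) \<Rightarrow> (nat \<Rightarrow> 'k) \<Rightarrow> ('v \<Rightarrow> 'v) \<Rightarrow> bool" where
  "transfers b b' g \<longleftrightarrow> Vector_Spaces.linear s s g \<and>
     (\<forall>\<beta>. Vector_Spaces.linear mF (*) \<beta> \<longrightarrow> g (P b \<beta>) = P b' \<beta>) \<and>
     (\<forall>j. r < j \<longrightarrow> j \<le> m \<longrightarrow> g (Y j) = Y j)"

lemma transfer_map:
  assumes b: "indep b" "indep b'" and U: "U b = U b'"
  shows "\<exists>g. transfers b b' g"
proof -
  obtain e where e: "dual_family mF b {0..r} e"
    using dual_family_exists[OF b(1) KF.vector_space_axioms] by blast
  have expand: "v = (\<Sum>j=0..r. mF (e j v) (b j))" if "v \<in> U b" for v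
    using dual_family_expand[OF b(1) KF.vector_space_axioms _ e that] by simp
  have indY: "independent_family s Y {1..m}" using Y by (simp add: basis_family_def)
  obtain g where g: "Vector_Spaces.linear s s g"
    "\<forall>j\<in>{1..m}. g (Y j) = (if j \<le> r then P b' (e j) else Y j)"
    using independent_family_extend[OF indY s s, of "\<lambda>j. if j \<le> r then P b' (e j) else Y j"]
    by blast
  interpret g: Vector_Spaces.linear s s g by (rule g(1))
  have gY: "g (Y j) = P b' (e j)" if "j \<in> {1..r}" for j
    using that g(2) r k by simp
  have "(\<Sum>j=0..r. s (b j) (P b' (e j)))
      = (\<Sum>j=0..r. \<Sum>i=0..r. s (b j * emb (e j (b' i))) (gen b' i))"
    by (simp add: P_def K.scale_sum_right restrict_scalars_def)
  also have "\<dots> = (\<Sum>i=0..r. s (\<Sum>j=0..r. mF (e j (b' i)) (b j)) (gen b' i))"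
    by (subst sum.swap) (simp add: K.scale_sum_left restrict_scalars_def mult.commute)
  also have "\<dots> = (\<Sum>i=0..r. s (b' i) (gen b' i))"
  proof (rule sum.cong[OF refl])
    fix i assume "i \<in> {0..r}"
    then have "b' i \<in> U b" unfolding U by (intro KF.span_base) auto
    then show "s (\<Sum>j=0..r. mF (e j (b' i)) (b j)) (gen b' i) = s (b' i) (gen b' i)"
      using expand by metis
  qed
  also have "\<dots> = 0" by (rule gen_relation[of b', OF indep_nonzero[OF b(2)]])
  finally have "(\<Sum>j=0..r. s (b j) (P b' (e j))) = (\<Sum>j=0..r. s (b j) (g (gen b j)))"
    using linear_family_sum[OF g(1), of b "gen b" "{0..r}"]
      gen_relation[of b, OF indep_nonzero[OF b(1)]] g.zero by simp
  moreover have "(\<Sum>j=1..r. s (b j) (P b' (e j))) = (\<Sum>j=1..r. s (b j) (g (gen b j)))"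
    by (intro sum.cong) (auto simp: gen_def gY)
  ultimately have "s (b 0) (P b' (e 0)) = s (b 0) (g (gen b 0))"
    by (simp add: sum.atLeast_Suc_atMost)
  then have "g (gen b 0) = P b' (e 0)"
    using indep_nonzero[OF b(1)] by simp
  then have g_gen: "g (gen b j) = P b' (e j)" if "j \<le> r" for j
    using that gY[of j] by (cases "j = 0") (auto simp: gen_def)
  have "g (P b \<beta>) = P b' \<beta>" if \<beta>: "Vector_Spaces.linear mF (*) \<beta>" for \<beta>
  proof -
    have \<beta>_eq: "\<beta> (b' i) = (\<Sum>j=0..r. e j (b' i) * \<beta> (b j))" if "i \<in> {0..r}" for i
    proof -
      have "b' i \<in> U b" unfolding U using that by (intro KF.span_base) auto
      then show ?thesis
        using arg_cong[OF expand, of "b' i" \<beta>] linear_family_sum[OF \<beta>] by simp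
    qed
    have "g (P b \<beta>) = (\<Sum>j=0..r. sF (\<beta> (b j)) (g (gen b j)))"
      unfolding P_def by (rule linear_family_sum[OF linear_restrict_scalars[OF emb s g(1)]])
    also have "\<dots> = (\<Sum>j=0..r. sF (\<beta> (b j)) (P b' (e j)))"
      by (intro sum.cong) (auto simp: g_gen)
    also have "\<dots> = (\<Sum>i=0..r. sF (\<Sum>j=0..r. e j (b' i) * \<beta> (b j)) (gen b' i))"
      unfolding P_def F.scale_sum_right
      by (subst sum.swap) (simp add: F.scale_sum_left mult.commute)
    also have "\<dots> = P b' \<beta>"
      unfolding P_def by (intro sum.cong) (auto simp: \<beta>_eq)
    finally show ?thesis .
  qed
  then have "transfers b b' g"
    using g by (auto simp: transfers_def)
  then show ?thesis by blast
qed

lemma gen_cases: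
  assumes "indep b"
  obtains "j \<le> r" "\<exists>\<beta>. Vector_Spaces.linear mF (*) \<beta> \<and> gen b j = P b \<beta>" | "r < j" "gen b j = Y j"
proof (cases "j \<le> r")
  case True
  obtain e where e: "dual_family mF b {0..r} e"
    using dual_family_exists[OF assms KF.vector_space_axioms] by blast
  have "P b (e j) = (\<Sum>i=0..r. if i = j then gen b i else 0)"
    unfolding P_def by (intro sum.cong) (auto simp: dual_family_apply[OF e] F.scale_one)
  then have "gen b j = P b (e j)" using True by simp
  then show thesis using that(1) True dual_family_linear[OF e] by metis
next
  case False
  then show thesis using that(2) by (simp add: gen_def)
qed

lemma T_orbit_if_U_eq:
  assumes b: "indep b" "indep b'" and U: "U b = U b'"
  shows "T b' \<in> orbit (GL s) image (T b)"
proof -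
  obtain g where g: "transfers b b' g"
    using transfer_map[OF b U] by blast
  obtain h where h: "transfers b' b h"
    using transfer_map[OF b(2,1) U[symmetric]] by blast
  have inverse: "h' (g' v) = v"
    if "indep b" and g': "transfers b b' g'" and h': "transfers b' b h'"
    for b b' g' h' v
  proof -
    have lin: "Vector_Spaces.linear s s g'" and lin': "Vector_Spaces.linear s s h'"
      using g' h' by (simp_all add: transfers_def)
    interpret vector_space_pair s s using s by (simp add: vector_space_pair_def)
    have "(h' \<circ> g') v = id v"
    proof (rule linear_eq_on[where f = "h' \<circ> g'" and g = id and B = "Y ` {1..m}"])
      show "v \<in> K.span (Y ` {1..m})" using Y by (simp add: basis_family_def)
      fix y assume "y \<in> Y ` {1..m}"
      then obtain j where j: "y = Y j" "1 \<le> j" "j \<le> m" by auto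
      then have y: "y = gen b j" by (simp add: gen_def)
      show "(h' \<circ> g') y = id y"
        using \<open>indep b\<close>
        by (rule gen_cases[where j = j]) (use g' h' y j in \<open>auto simp: transfers_def\<close>)
    qed (auto intro: Vector_Spaces.linear_compose[OF lin lin'] K.linear_id)
    then show ?thesis by simp
  qed
  have hg: "h (g v) = v" for v by (rule inverse[OF b(1) g h])
  have gh: "g (h v) = v" for v by (rule inverse[OF b(2) h g])
  have image: "g' ` T b \<subseteq> T b'"
    if "indep b" and g': "transfers b b' g'"
    for b b' g'
  proof -
    have lin: "Vector_Spaces.linear s s g'"
      using g' by (simp add: transfers_def)
    interpret Vector_Spaces.linear sF sF g' by (rule linear_restrict_scalars[OF emb s lin])
    have "g' (gen b j) \<in> T b'" if "j \<in> {0..k-1}" for j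
      using \<open>indep b\<close>
    proof (rule gen_cases[where j = j])
      assume "\<exists>\<beta>. Vector_Spaces.linear mF (*) \<beta> \<and> gen b j = P b \<beta>"
      then show ?thesis using g' P_in_T by (auto simp: transfers_def)
    next
      assume "r < j" and j: "gen b j = Y j"
      then have "g' (gen b j) = gen b' j" using that k g' by (auto simp: gen_def transfers_def)
      then show ?thesis using that by (auto simp: T_def intro: F.span_base)
    qed
    then have "F.span (g' ` gen b ` {0..k-1}) \<subseteq> T b'"
      unfolding T_def by (intro F.span_minimal) auto
    then show ?thesis by (simp add: T_def span_image)
  qed
  have "T b' = g ` T b"
  proof
    show "g ` T b \<subseteq> T b'" by (rule image[OF b(1) g])
    have "g ` h ` T b' \<subseteq> g ` T b" by (intro image_mono image[OF b(2) h])
    then show "T b' \<subseteq> g ` T b" by (simp add: image_comp o_def gh)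
  qed
  moreover have "bij g" by (rule o_bij[of h]) (auto simp: hg gh)
  ultimately show ?thesis using g by (auto simp: orbit_def GL_def transfers_def)
qed

lemma linear_times: "Vector_Spaces.linear mF mF ((*) a)"
  unfolding Vector_Spaces.linear_iff
  by (intro conjI KF.vector_space_axioms) (simp_all add: restrict_scalars_def algebra_simps)

lemma indep_scaled:
  assumes "a \<noteq> 0" "indep b"
  shows "indep (\<lambda>i. a * b i)"
proof -
  interpret Vector_Spaces.linear mF mF "(*) a" by (rule linear_times)
  have "inj ((*) a)" using assms(1) by (simp add: inj_on_def)
  then have "KF.independent ((*) a ` b ` {0..r})"
    using assms(2) by (intro independent_injective_image) (auto simp: independent_family_def inj_on_def)
  moreover have "inj_on (\<lambda>i. a * b i) {0..r}"
    using assms by (auto simp: independent_family_def inj_on_def)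
  ultimately show ?thesis
    by (simp add: independent_family_def image_image)
qed

lemma U_scaled: "U (\<lambda>i. a * b i) = (*) a ` U b"
proof -
  interpret Vector_Spaces.linear mF mF "(*) a" by (rule linear_times)
  show ?thesis by (simp add: span_image[symmetric] image_image)
qed

lemma T_scaled: "a \<noteq> 0 \<Longrightarrow> T (\<lambda>i. a * b i) = T b"
  by (simp add: T_eq_T_space)

lemma admissible_indep: "admissible emb r u \<longleftrightarrow> indep (u(0 := 1))"
  by (simp add: admissible_def)

lemma T_space_eq_T: "T_space emb s Y k r u = T (u(0 := 1))"
  unfolding T_eq_T_space T_space_def by (intro arg_cong[of _ _ F.span] arg_cong2[of _ _ _ _ insert] sum.cong) auto

lemma span_1u_eq_U: "span_1u emb r u = U (u(0 := 1))"
proof -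
  have "{0..r} = insert 0 {1..r}" by auto
  then have "(u(0 := 1)) ` {0..r} = insert 1 (u ` {1..r})" by auto
  then show ?thesis by (simp add: span_1u_def)
qed

lemma mem_orbit_Singer: "W \<in> orbit Singer image W' \<longleftrightarrow> (\<exists>a. a \<noteq> 0 \<and> W = (*) a ` W')"
  by (auto simp: orbit_def Singer_def)

lemma T_orbit_iff_U_orbit:
  assumes "indep b" "indep b'"
  shows "T b' \<in> orbit (GL s) image (T b) \<longleftrightarrow> U b \<in> orbit Singer image (U b')"
proof
  assume "T b' \<in> orbit (GL s) image (T b)"
  then show "U b \<in> orbit Singer image (U b')"
    using U_scaled_if_T_orbit[OF assms] unfolding mem_orbit_Singer by metis
next
  assume "U b \<in> orbit Singer image (U b')"
  then obtain a where a: "a \<noteq> 0" "U b = U (\<lambda>i. a * b' i)"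
    by (auto simp: mem_orbit_Singer U_scaled)
  then have "T (\<lambda>i. a * b' i) \<in> orbit (GL s) image (T b)"
    using assms by (intro T_orbit_if_U_eq indep_scaled)
  then show "T b' \<in> orbit (GL s) image (T b)"
    using a(1) by (simp add: T_scaled)
qed

lemma orbits_Omega:
  "orbits (GL s) (Omega emb s Y k r) image
     = (\<lambda>u. orbit (GL s) image (T_space emb s Y k r u)) ` {u. admissible emb r u}"
proof (intro equalityI subsetI)
  fix B assume "B \<in> orbits (GL s) (Omega emb s Y k r) image"
  then obtain x u where "B = orbit (GL s) image x" "admissible emb r u"
      "x \<in> orbit (GL s) image (T_space emb s Y k r u)"
    by (auto simp: orbits_def Omega_def)
  then show "B \<in> (\<lambda>u. orbit (GL s) image (T_space emb s Y k r u)) ` {u. admissible emb r u}"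
    using group_action.orbit_eq_iff[OF group_action_GL[OF s]] by auto
next
  fix B assume "B \<in> (\<lambda>u. orbit (GL s) image (T_space emb s Y k r u)) ` {u. admissible emb r u}"
  then show "B \<in> orbits (GL s) (Omega emb s Y k r) image"
    using group_action.orbit_refl[OF group_action_GL[OF s]] by (auto simp: orbits_def Omega_def)
qed

lemma singer_orbits_eq:
  "singer_orbits emb (r + 1)
     = (\<lambda>u. orbit Singer image (span_1u emb r u)) ` {u. admissible emb r u}"
proof (intro equalityI subsetI)
  fix B assume "B \<in> singer_orbits emb (r + 1)"
  then obtain W where B: "B = orbit Singer image W"
    and W: "KF.subspace W" "KF.dim W = r + 1"
    by (auto simp: singer_orbits_def orbits_def subspaces_dim_def)
  obtain X where X: "X \<subseteq> W" "KF.independent X" "W \<subseteq> KF.span X" "card X = r + 1"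
    using KF.basis_exists[of W] W(2) by metis
  then have "finite X" by (simp add: card_ge_0_finite)
  then obtain h where "bij_betw h {0..<r + 1} X"
    using ex_bij_betw_nat_finite X(4) by metis
  moreover have "{0..<r + 1} = {0..r}" by auto
  ultimately have h: "inj_on h {0..r}" "h ` {0..r} = X"
    by (auto simp: bij_betw_def)
  then have ind: "indep h" using X(2) by (simp add: independent_family_def)
  define u where "u i = inverse (h 0) * h i" for i
  have u: "u(0 := 1) = (\<lambda>i. inverse (h 0) * h i)"
    using indep_nonzero[OF ind] by (auto simp: u_def)
  have "W = U h"
    unfolding h(2) using X(1,3) KF.span_minimal[OF X(1) W(1)] by blast
  then have "span_1u emb r u = (*) (inverse (h 0)) ` W"
    by (simp add: span_1u_eq_U u U_scaled)
  then have "span_1u emb r u \<in> orbit Singer image W"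
    using indep_nonzero[OF ind] by (auto simp: mem_orbit_Singer intro!: exI[of _ "inverse (h 0)"])
  then have "B = orbit Singer image (span_1u emb r u)"
    unfolding B using group_action.orbit_eq_iff[OF group_action_Singer] by auto
  moreover have "admissible emb r u"
    using indep_scaled[OF _ ind, of "inverse (h 0)"] indep_nonzero[OF ind]
    by (simp add: admissible_indep u)
  ultimately show "B \<in> (\<lambda>u. orbit Singer image (span_1u emb r u)) ` {u. admissible emb r u}"
    by blast
next
  fix B assume "B \<in> (\<lambda>u. orbit Singer image (span_1u emb r u)) ` {u. admissible emb r u}"
  then obtain u where u: "indep (u(0 := 1))" and B: "B = orbit Singer image (U (u(0 := 1)))"
    by (auto simp: admissible_indep span_1u_eq_U)
  have "KF.dim (U (u(0 := 1))) = card ((u(0 := 1)) ` {0..r})"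
    using u by (intro KF.dim_span_eq_card_independent) (simp add: independent_family_def)
  also have "\<dots> = r + 1"
    using u by (subst card_image) (auto simp: independent_family_def)
  finally have "U (u(0 := 1)) \<in> subspaces_dim mF (r + 1)"
    by (simp add: subspaces_dim_def KF.subspace_span)
  then show "B \<in> singer_orbits emb (r + 1)"
    unfolding singer_orbits_def orbits_def B by blast
qed

lemma orbit_T_space_eq_iff:
  assumes "admissible emb r u" "admissible emb r w"
  shows "orbit (GL s) image (T_space emb s Y k r u) = orbit (GL s) image (T_space emb s Y k r w)
    \<longleftrightarrow> orbit Singer image (span_1u emb r u) = orbit Singer image (span_1u emb r w)"
proof -
  have "T_space emb s Y k r w \<in> orbit (GL s) image (T_space emb s Y k r u)
      \<longleftrightarrow> span_1u emb r u \<in> orbit Singer image (span_1u emb r w)"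
    unfolding T_space_eq_T span_1u_eq_U
    using assms by (intro T_orbit_iff_U_orbit) (simp_all add: admissible_indep)
  then show ?thesis
    using group_action.orbit_eq_iff[OF group_action_GL[OF s] UNIV_I UNIV_I]
      group_action.orbit_eq_iff[OF group_action_Singer UNIV_I UNIV_I] by metis
qed

end

lemma Singer_stab_orbit:
  assumes "W' \<in> orbit Singer image W"
  shows "Singer_stab W' = Singer_stab W"
proof -
  obtain a where a: "a \<noteq> 0" "W' = (*) a ` W"
    using assms by (auto simp: orbit_def Singer_def)
  have "(*) c ` W' = W' \<longleftrightarrow> (*) c ` W = W" for c
  proof -
    have "(*) c ` W' = (*) a ` (*) c ` W"
      by (simp add: a(2) image_image mult.left_commute)
    moreover have "inj ((*) a)" using a(1) by (simp add: inj_on_def)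
    ultimately show ?thesis using a(2) by (simp add: inj_image_eq_iff)
  qed
  then have "g ` W' = W' \<longleftrightarrow> g ` W = W" if "g \<in> carrier Singer" for g
  proof -
    obtain c where "g = (*) c" using \<open>g \<in> carrier Singer\<close> by (auto simp: Singer_def)
    then show ?thesis by (simp only: \<open>\<And>c. (*) c ` W' = W' \<longleftrightarrow> (*) c ` W = W\<close>)
  qed
  then have "stabilizer Singer image W' = stabilizer Singer image W"
    unfolding stabilizer_def by blast
  then show ?thesis by (simp add: Singer_stab_def)
qed

lemma card_image_eq_if_same_fibres:
  assumes "\<And>x y. x \<in> A \<Longrightarrow> y \<in> A \<Longrightarrow> f x = f y \<longleftrightarrow> g x = g y"
  shows "card (f ` A) = card (g ` A)"
proof (rule bij_betw_same_card)
  have "g (inv_into A f (f x)) = g x" if "x \<in> A" for x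
    using assms[of "inv_into A f (f x)" x] that by (simp add: f_inv_into_f inv_into_into)
  then show "bij_betw (\<lambda>z. g (inv_into A f z)) (f ` A) (g ` A)"
    using assms by (auto simp: bij_betw_def inj_on_def image_image)
qed

lemma (in group_action) card_complete_representatives:
  assumes "complete_representatives G D \<phi> R" "D \<subseteq> E"
  shows "card (orbits G D \<phi>) = card R"
proof -
  have R: "R \<subseteq> D" "\<And>B. B \<in> orbits G D \<phi> \<Longrightarrow> \<exists>!x. x \<in> R \<and> x \<in> B"
    using assms(1) by (auto simp: complete_representatives_def)
  have mem: "orbit G \<phi> x \<in> orbits G D \<phi>" "x \<in> orbit G \<phi> x" if "x \<in> R" for x
    using that R(1) assms(2) orbit_refl by (auto simp: orbits_def)
  have "bij_betw (orbit G \<phi>) R (orbits G D \<phi>)"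
    unfolding bij_betw_def
  proof (intro conjI inj_onI equalityI subsetI)
    fix x y assume xy: "x \<in> R" "y \<in> R" "orbit G \<phi> x = orbit G \<phi> y"
    then show "x = y" using R(2)[OF mem(1)[OF xy(1)]] mem(2) by metis
  next
    fix B assume B: "B \<in> orbits G D \<phi>"
    then obtain x where "x \<in> R" "x \<in> B" using R(2) by blast
    moreover obtain y where "y \<in> D" "B = orbit G \<phi> y" using B by (auto simp: orbits_def)
    ultimately have "B = orbit G \<phi> x"
      using orbit_eq_iff R(1) assms(2) by blast
    then show "B \<in> orbit G \<phi> ` R" using \<open>x \<in> R\<close> by blast
  qed (use mem in auto)
  then show ?thesis by (metis bij_betw_same_card)
qed

theorem corollary3p3:
  fixes emb :: "'f::{field,finite} \<Rightarrow> 'k::{field,finite}"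
    and s :: "'k \<Rightarrow> 'v::ab_group_add \<Rightarrow> 'v"
    and Y :: "nat \<Rightarrow> 'v"
    and q m l k r :: nat
    and \<F> :: "'v set set"
  assumes "primepow q"
    and "CARD('f) = q"
    and "CARD('k) = q ^ l"
    and "field_embedding emb"
    and "vector_space s"
    and "basis_family s Y {1..m}"
    and "3 \<le> k" and "k \<le> min (m + 1) l"
    and "1 \<le> r" and "r \<le> k - 1"
    and "complete_representatives (GL s) (Omega emb s Y k r) image \<F>"
  shows "card (orbits (GL s) (Omega emb s Y k r) image) = card \<F>
    \<and> card \<F> = n_orb emb (r + 1)
    \<and> (\<forall>(u::nat) (F :: 'e ring).
         0 < u \<longrightarrow> u dvd gcd (r + 1) l \<longrightarrow> field F \<longrightarrow> card (carrier F) = q ^ u \<longrightarrow>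
         card {B \<in> orbits (GL s) (Omega emb s Y k r) image.
                 \<exists>w. admissible emb r w \<and> T_space emb s Y k r w \<in> B
                   \<and> Singer_stab (span_1u emb r w) \<cong> mult_of F}
           = n_orb_stab emb (r + 1) F)"
proof -
  interpret T_spaces emb s Y m k r
    by (intro T_spaces.intro) (use assms in auto)
  let ?A = "{u. admissible emb r u}"
  let ?f = "\<lambda>u. orbit (GL s) image (T_space emb s Y k r u)"
  let ?g = "\<lambda>u. orbit Singer image (span_1u emb r u)"
  have card_eq: "card (?f ` {u \<in> ?A. Q u}) = card (?g ` {u \<in> ?A. Q u})" for Q
    by (rule card_image_eq_if_same_fibres) (simp add: orbit_T_space_eq_iff)
  have reps: "card (orbits (GL s) (Omega emb s Y k r) image) = card \<F>"
    using group_action.card_complete_representatives[OF group_action_GL[OF s] assms(11)] by simp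
  have "card (orbits (GL s) (Omega emb s Y k r) image) = n_orb emb (r + 1)"
    unfolding orbits_Omega n_orb_def singer_orbits_eq using card_eq[of "\<lambda>_. True"] by simp
  moreover have "card {B \<in> orbits (GL s) (Omega emb s Y k r) image.
                 \<exists>w. admissible emb r w \<and> T_space emb s Y k r w \<in> B
                   \<and> Singer_stab (span_1u emb r w) \<cong> mult_of F}
           = n_orb_stab emb (r + 1) F" for F :: "'e ring"
  proof -
    let ?Q = "\<lambda>w. Singer_stab (span_1u emb r w) \<cong> mult_of F"
    have "{B \<in> ?f ` ?A. \<exists>w. admissible emb r w \<and> T_space emb s Y k r w \<in> B \<and> ?Q w}
        = ?f ` {w \<in> ?A. ?Q w}"
    proof (intro equalityI subsetI)
      fix B assume "B \<in> {B \<in> ?f ` ?A. \<exists>w. admissible emb r w \<and> T_space emb s Y k r w \<in> B \<and> ?Q w}"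
      then obtain u w where "B = ?f u" "admissible emb r w" "T_space emb s Y k r w \<in> ?f u" "?Q w"
        by blast
      moreover have "?f u = ?f w"
        using calculation(3) group_action.orbit_eq_iff[OF group_action_GL[OF s]] by blast
      ultimately show "B \<in> ?f ` {w \<in> ?A. ?Q w}" by blast
    next
      fix B assume "B \<in> ?f ` {w \<in> ?A. ?Q w}"
      then obtain w where "B = ?f w" "admissible emb r w" "?Q w" by blast
      moreover have "T_space emb s Y k r w \<in> ?f w"
        using group_action.orbit_refl[OF group_action_GL[OF s]] by blast
      ultimately show "B \<in> {B \<in> ?f ` ?A. \<exists>w. admissible emb r w \<and> T_space emb s Y k r w \<in> B \<and> ?Q w}"
        by blast
    qed
    moreover have "{B \<in> ?g ` ?A. \<forall>W\<in>B. Singer_stab W \<cong> mult_of F} = ?g ` {w \<in> ?A. ?Q w}"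
    proof -
      have "(\<forall>W\<in>?g w. Singer_stab W \<cong> mult_of F) \<longleftrightarrow> ?Q w" for w
        using Singer_stab_orbit group_action.orbit_refl[OF group_action_Singer] by (metis UNIV_I)
      then show ?thesis by blast
    qed
    ultimately show ?thesis
      unfolding orbits_Omega n_orb_stab_def singer_orbits_eq using card_eq[of ?Q] by simp
  qed
  ultimately show ?thesis
    using reps by simp
qed

end
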